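(* Let $m<s<M$ be real numbers, let $\kappa=\frac12(s-2m-M)$, let $\phi$ be the cuspon profile with parameters $m,s,M$, and let $u(t,x)=\phi(x-(s+\kappa)t)+\kappa$ be the cuspon with exponential decay, with speed $s+\kappa$. Let $y(t,\xi)$ be the characteristics of $u$ in Lagrangian coordinates. If $T\ge0$ and $\tilde\xi\in\mathbb{R}$ are such that $y(T,\tilde\xi)=(s+\kappa)T$, then $$y(t,\tilde\xi)<(s+\kappa)t\qquad\text{for all } t>T.$$ In particular, the cusp, located at $x=(s+\kappa)t$ at time $t$, does not travel along a single characteristic.
   Context: The cuspon profile with parameters $m<s<M$ is the continuous function $\phi:\mathbb{R}\to\mathbb{R}$, differentiable on $\mathbb{R}\setminus\{0\}$, given implicitly by $$\phi_x^2=\frac{(M-\phi)(\phi-m)^2}{s-\phi}\quad\text{on }\mathbb{R}\setminus\{0\},$$ together with $\phi(-x)=\phi(x)$, $\phi(0)=s$, $\phi_x(x)<0$ for $x>0$, and $\lim_{x\to\infty}\phi(x)=m$. The function $u(t,x)=\phi(x-(s+\kappa)t)+\kappa$ is a travelling wave (conservative) solution of the Camassa--Holm equation $u_t-u_{txx}+3uu_x-2u_xu_{xx}-uu_{xxx}=0$, with energy measure $\mu(t)=u_x^2(t,x)\,dx$ and with $u(t,\cdot)-c\in H^1(\mathbb{R})$, where $c=m+\kappa$. Lagrangian coordinates: the initial data are $$y(0,\xi)=\sup\left\{y\ \middle|\ \int_{-\infty}^{y}u_x^2(0,z)\,dz+y<\xi\right\},\quad h(0,\xi)=1-y_\xi(0,\xi),\quad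 U(0,\xi)=u(0,y(0,\xi)).$$ With $y(t,\xi)=\xi+\zeta(t,\xi)$, the triple $(\zeta,U,h)(t)$ is the unique global solution with these initial data of $$\zeta_t=U,\quad \zeta_{\xi,t}=U_\xi,\quad U_t=-Q,\quad U_{\xi,t}=\tfrac12h+(U^2-P)y_\xi,\quad h_t=2(U^2-P)U_\xi,$$ where $$P(t,\xi)=\tfrac14\int_{\mathbb{R}}e^{-|y(t,\xi)-y(t,\eta)|}(2U^2y_\xi+h)(t,\eta)\,d\eta,$$ $$Q(t,\xi)=-\tfrac14\int_{\mathbb{R}}\mathrm{sign}(\xi-\eta)e^{-|y(t,\xi)-y(t,\eta)|}(2U^2y_\xi+h)(t,\eta)\,d\eta.$$ The solution lies, for each $t$, in the set of triples with $\zeta\in L^\infty(\mathbb{R})$; $U-c\in H^1(\mathbb{R})$; $h,\zeta_\xi,U_\xi\in L^\infty(\mathbb{R})\cap L^2(\mathbb{R})$; $y_\xi\ge0$, $h\ge0$, $y_\xi+h>0$ and $y_\xi h=U_\xi^2$ a.e.; and $y+\int_{-\infty}^{\xi}h\,d\eta$ in the group of homeomorphisms $f$ of $\mathbb{R}$ with $f-\mathrm{Id},\,f^{-1}-\mathrm{Id}\in W^{1,\infty}(\mathbb{R})$ and $f_\xi-1\in L^2(\mathbb{R})$. The curves $t\mapsto y(t,\xi)$ are the characteristics. Since $u$ is the conservative solution, they satisfy $y_t(t,\xi)=U(t,\xi)=u(t,y(t,\xi))=\phi(y(t,\xi)-(s+\kappa)t)+\kappa$ and $Q(t,\xi)=P_x(t,y(t,\xi))$,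 where on the right-hand side $P(t,x)=\frac14\int_{\mathbb{R}}e^{-|x-z|}(2u^2+u_x^2)(t,z)\,dz$. *)

theory Defs
  imports "HOL-Analysis.Analysis"
begin

section \<open>The cuspon\<close>

definition cuspon_profile :: "real \<Rightarrow> real \<Rightarrow> real \<Rightarrow> (real \<Rightarrow> real) \<Rightarrow> bool" where
  "cuspon_profile m s M \<phi> \<longleftrightarrow>
     continuous_on UNIV \<phi> \<and>
     (\<forall>x. x \<noteq> 0 \<longrightarrow> \<phi> field_differentiable (at x)) \<and>
     (\<forall>x. x \<noteq> 0 \<longrightarrow> (deriv \<phi> x)\<^sup>2 = (M - \<phi> x) * (\<phi> x - m)\<^sup>2 / (s - \<phi> x)) \<and>
     (\<forall>x. \<phi> (- x) = \<phi> x) \<and>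
     \<phi> 0 = s \<and>
     (\<forall>x>0. deriv \<phi> x < 0) \<and>
     (\<phi> \<longlongrightarrow> m) at_top"

definition cuspon_wave :: "(real \<Rightarrow> real) \<Rightarrow> real \<Rightarrow> real \<Rightarrow> real \<Rightarrow> real \<Rightarrow> real" where
  "cuspon_wave \<phi> s \<kappa> t x = \<phi> (x - (s + \<kappa>) * t) + \<kappa>"


section \<open>Function spaces on the real line\<close>

definition in_L2 :: "(real \<Rightarrow> real) \<Rightarrow> bool" where
  "in_L2 f \<longleftrightarrow> f \<in> borel_measurable lborel \<and> integrable lborel (\<lambda>x. (f x)\<^sup>2)"

definition in_Linf :: "(real \<Rightarrow> real) \<Rightarrow> bool" where
  "in_Linf f \<longleftrightarrow> f \<in> borel_measurable lborel \<and> (\<exists>C. AE x in lborel. \<bar>f x\<bar> \<le> C)"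

text \<open>The function \<open>g\<close> represents the weak derivative of \<open>f\<close>, with \<open>f\<close> taken as its (locally
  absolutely) continuous representative. The choice of \<open>g\<close> matters only up to null sets.\<close>

definition weak_deriv :: "(real \<Rightarrow> real) \<Rightarrow> (real \<Rightarrow> real) \<Rightarrow> bool" where
  "weak_deriv f g \<longleftrightarrow>
     (\<forall>a b. a \<le> b \<longrightarrow> set_integrable lborel {a..b} g \<and>
        f b - f a = (LINT x:{a..b}|lborel. g x))"

definition in_W1inf :: "(real \<Rightarrow> real) \<Rightarrow> bool" where
  "in_W1inf f \<longleftrightarrow> in_Linf f \<and> (\<exists>g. weak_deriv f g \<and> in_Linf g)"

definition relabeling :: "(real \<Rightarrow> real) \<Rightarrow> bool" where
  "relabeling f \<longleftrightarrow>
     homeomorphism UNIV UNIV f (inv f) \<and>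
     in_W1inf (\<lambda>x. f x - x) \<and> in_W1inf (\<lambda>x. inv f x - x) \<and>
     (\<exists>g. weak_deriv (\<lambda>x. f x - x) g \<and> in_L2 g)"


section \<open>Lagrangian coordinates\<close>

text \<open>Below, \<open>\<zeta>\<xi>\<close> and \<open>U\<xi>\<close> are representatives of the weak derivatives of \<open>\<zeta>\<close> and \<open>U\<close> in the
  label \<open>\<xi>\<close>, so that \<open>1 + \<zeta>\<xi>\<close> represents the derivative of \<open>y\<close>. Functions of
  \<open>(t, \<xi>)\<close> are curried with \<open>t\<close> first.\<close>

definition characteristic :: "(real \<Rightarrow> real \<Rightarrow> real) \<Rightarrow> real \<Rightarrow> real \<Rightarrow> real" where
  "characteristic \<zeta> t \<xi> = \<xi> + \<zeta> t \<xi>"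

text \<open>In the last conjunct \<open>h\<close> is integrable, so the integral is the genuine one:
  \<open>h = U\<xi>\<^sup>2 - \<zeta>\<xi> * h\<close> a.e., and both terms are integrable by the preceding conjuncts.\<close>

definition lagrangian_set ::
  "real \<Rightarrow> (real \<Rightarrow> real) \<Rightarrow> (real \<Rightarrow> real) \<Rightarrow> (real \<Rightarrow> real) \<Rightarrow> (real \<Rightarrow> real) \<Rightarrow> (real \<Rightarrow> real) \<Rightarrow> bool"
where
  "lagrangian_set c \<zeta> U h \<zeta>\<xi> U\<xi> \<longleftrightarrow>
     weak_deriv \<zeta> \<zeta>\<xi> \<and> weak_deriv U U\<xi> \<and>
     in_Linf \<zeta> \<and>
     in_L2 (\<lambda>\<xi>. U \<xi> - c) \<and>
     in_Linf h \<and> in_L2 h \<and> in_Linf \<zeta>\<xi> \<and> in_L2 \<zeta>\<xi> \<and> in_Linf U\<xi> \<and> in_L2 U\<xi> \<and>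
     (AE \<xi> in lborel. 1 + \<zeta>\<xi> \<xi> \<ge> 0 \<and> h \<xi> \<ge> 0 \<and> (1 + \<zeta>\<xi> \<xi>) + h \<xi> > 0 \<and>
        (1 + \<zeta>\<xi> \<xi>) * h \<xi> = (U\<xi> \<xi>)\<^sup>2) \<and>
     relabeling (\<lambda>\<xi>. (\<xi> + \<zeta> \<xi>) + (LINT \<eta>:{..\<xi>}|lborel. h \<eta>))"

definition lagrangian_P ::
  "(real \<Rightarrow> real \<Rightarrow> real) \<Rightarrow> (real \<Rightarrow> real \<Rightarrow> real) \<Rightarrow> (real \<Rightarrow> real \<Rightarrow> real) \<Rightarrow> (real \<Rightarrow> real \<Rightarrow> real)
    \<Rightarrow> real \<Rightarrow> real \<Rightarrow> real" where
  "lagrangian_P \<zeta> U h \<zeta>\<xi> t \<xi> =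
     1/4 * (LINT \<eta>|lborel. exp (- \<bar>characteristic \<zeta> t \<xi> - characteristic \<zeta> t \<eta>\<bar>) *
        (2 * (U t \<eta>)\<^sup>2 * (1 + \<zeta>\<xi> t \<eta>) + h t \<eta>))"

definition lagrangian_Q ::
  "(real \<Rightarrow> real \<Rightarrow> real) \<Rightarrow> (real \<Rightarrow> real \<Rightarrow> real) \<Rightarrow> (real \<Rightarrow> real \<Rightarrow> real) \<Rightarrow> (real \<Rightarrow> real \<Rightarrow> real)
    \<Rightarrow> real \<Rightarrow> real \<Rightarrow> real" where
  "lagrangian_Q \<zeta> U h \<zeta>\<xi> t \<xi> =
     - (1/4) * (LINT \<eta>|lborel. sgn (\<xi> - \<eta>) *
        exp (- \<bar>characteristic \<zeta> t \<xi> - characteristic \<zeta> t \<eta>\<bar>) *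
        (2 * (U t \<eta>)\<^sup>2 * (1 + \<zeta>\<xi> t \<eta>) + h t \<eta>))"

text \<open>Forward-in-time solutions. The equations for the continuous unknowns \<open>\<zeta>\<close>, \<open>U\<close> hold at every
  label, those for \<open>\<zeta>\<xi>\<close>, \<open>U\<xi>\<close>, \<open>h\<close> (which are only defined up to null sets in \<open>\<xi>\<close>) at almost
  every label, at all times. The derivative at \<open>t = 0\<close> is one-sided.\<close>

definition lagrangian_solution ::
  "real \<Rightarrow> (real \<Rightarrow> real \<Rightarrow> real) \<Rightarrow> (real \<Rightarrow> real \<Rightarrow> real) \<Rightarrow> (real \<Rightarrow> real \<Rightarrow> real)
    \<Rightarrow> (real \<Rightarrow> real \<Rightarrow> real) \<Rightarrow> (real \<Rightarrow> real \<Rightarrow> real) \<Rightarrow> bool" where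
  "lagrangian_solution c \<zeta> U h \<zeta>\<xi> U\<xi> \<longleftrightarrow>
     (\<forall>t\<ge>0. lagrangian_set c (\<zeta> t) (U t) (h t) (\<zeta>\<xi> t) (U\<xi> t)) \<and>
     (\<forall>\<xi>. \<forall>t\<ge>0.
        ((\<lambda>\<tau>. \<zeta> \<tau> \<xi>) has_real_derivative U t \<xi>) (at t within {0..}) \<and>
        ((\<lambda>\<tau>. U \<tau> \<xi>) has_real_derivative - lagrangian_Q \<zeta> U h \<zeta>\<xi> t \<xi>) (at t within {0..})) \<and>
     (AE \<xi> in lborel. \<forall>t\<ge>0.
        ((\<lambda>\<tau>. \<zeta>\<xi> \<tau> \<xi>) has_real_derivative U\<xi> t \<xi>) (at t within {0..}) \<and>
        ((\<lambda>\<tau>. U\<xi> \<tau> \<xi>) has_real_derivative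
           1/2 * h t \<xi> + ((U t \<xi>)\<^sup>2 - lagrangian_P \<zeta> U h \<zeta>\<xi> t \<xi>) * (1 + \<zeta>\<xi> t \<xi>))
           (at t within {0..}) \<and>
        ((\<lambda>\<tau>. h \<tau> \<xi>) has_real_derivative
           2 * ((U t \<xi>)\<^sup>2 - lagrangian_P \<zeta> U h \<zeta>\<xi> t \<xi>) * U\<xi> t \<xi>) (at t within {0..}))"

text \<open>Initial data for an initial energy measure without singular part. If \<open>u\<^sub>0\<close> is differentiable
  almost everywhere, the arbitrary value of \<open>deriv\<close> at the remaining points does not matter.\<close>

definition initial_data ::
  "(real \<Rightarrow> real) \<Rightarrow> (real \<Rightarrow> real) \<Rightarrow> (real \<Rightarrow> real) \<Rightarrow> (real \<Rightarrow> real) \<Rightarrow> (real \<Rightarrow> real) \<Rightarrow> bool"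
where
  "initial_data u\<^sub>0 \<zeta>\<^sub>0 U\<^sub>0 h\<^sub>0 \<zeta>\<xi>\<^sub>0 \<longleftrightarrow>
     (\<forall>\<xi>. \<xi> + \<zeta>\<^sub>0 \<xi> = Sup {y. (LINT z:{..y}|lborel. (deriv u\<^sub>0 z)\<^sup>2) + y < \<xi>}) \<and>
     (\<forall>\<xi>. U\<^sub>0 \<xi> = u\<^sub>0 (\<xi> + \<zeta>\<^sub>0 \<xi>)) \<and>
     (AE \<xi> in lborel. h\<^sub>0 \<xi> = 1 - (1 + \<zeta>\<xi>\<^sub>0 \<xi>))"

text \<open>The function \<open>u\<close> is the conservative solution obtained from the Lagrangian solution whose
  initial data are given by \<open>u 0\<close>: one goes back to Eulerian coordinates by
  \<open>u t x = U t \<xi>\<close> for any \<open>\<xi>\<close> with \<open>y t \<xi> = x\<close>.\<close>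

definition conservative_solution ::
  "real \<Rightarrow> (real \<Rightarrow> real \<Rightarrow> real) \<Rightarrow> (real \<Rightarrow> real \<Rightarrow> real) \<Rightarrow> (real \<Rightarrow> real \<Rightarrow> real)
    \<Rightarrow> (real \<Rightarrow> real \<Rightarrow> real) \<Rightarrow> (real \<Rightarrow> real \<Rightarrow> real) \<Rightarrow> (real \<Rightarrow> real \<Rightarrow> real) \<Rightarrow> bool" where
  "conservative_solution c u \<zeta> U h \<zeta>\<xi> U\<xi> \<longleftrightarrow>
     lagrangian_solution c \<zeta> U h \<zeta>\<xi> U\<xi> \<and>
     initial_data (u 0) (\<zeta> 0) (U 0) (h 0) (\<zeta>\<xi> 0) \<and>
     (\<forall>t\<ge>0. \<forall>\<xi>. u t (characteristic \<zeta> t \<xi>) = U t \<xi>)"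

end

theory Submission
  imports Defs
begin

text \<open>
  Relative to the cusp, a characteristic \<open>z(t) = y(t,\<xi>) - (s + \<kappa>) t\<close> solves
  \<open>z' = \<phi>(z) - s\<close>. The right-hand side is nonpositive, so \<open>z\<close> never increases, but it behaves
  like \<open>-\<bar>z\<bar> powr (2/3)\<close>, up to a constant, at the origin and the equation also has the solution \<open>z = 0\<close>. The scalar
  equation cannot tell the stationary solution from the one that leaves the cusp to the left. The
  symmetry of the wave gives \<open>P\<^sub>x = 0\<close> at the cusp, so the equation \<open>U\<^sub>t = -Q\<close> along that
  single label does not help either. What decides is the evolution of the energy at neighbouring
  labels.

  Suppose that the label \<open>\<xi>\<^sub>0\<close> sits on the cusp during a whole interval \<open>[T,S]\<close>. Labels slightly to
  the right of \<open>\<xi>\<^sub>0\<close> then stay within a small distance to the right of the cusp during \<open>[T,S]\<close>: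
  characteristics do not cross, and none of them gains on the cusp. There \<open>u\<close> decreases
  with slope below \<open>-1/e\<close>, so \<open>y\<^sub>\<xi> \<le> -e U\<^sub>\<xi>\<close>
  (\<open>cuspon_profile_steep_at_crest\<close>, \<open>lagrangian_set_slopes\<close>), and with
  \<open>y\<^sub>\<xi> h = U\<^sub>\<xi>\<^sup>2\<close> the ratio \<open>r = U\<^sub>\<xi> / h\<close>, which is the reciprocal \<open>1/u\<^sub>x\<close> of the slope, lies
  in \<open>[-e, 0]\<close>. But the linear equations for \<open>y\<^sub>\<xi>\<close>, \<open>U\<^sub>\<xi>\<close>, \<open>h\<close> give the Riccati equation
  \<open>r' = 1/2 + (P - U\<^sup>2) r\<^sup>2\<close>, and \<open>P \<ge> 0\<close> makes its right-hand side at least \<open>1/4\<close> when \<open>e\<close> is small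
  compared with the bound on \<open>U\<close>. So \<open>r\<close> becomes positive before time \<open>S\<close> once
  \<open>4 e < S - T\<close>, which is impossible (\<open>reciprocal_slope_contradiction\<close>).
\<close>

section \<open>Weak derivatives of functions on the line\<close>

lemma weak_deriv_add:
  assumes "weak_deriv f f'" "weak_deriv g g'"
  shows "weak_deriv (\<lambda>x. f x + g x) (\<lambda>x. f' x + g' x)"
  using assms unfolding weak_deriv_def by (fastforce simp: set_integral_add)

lemma weak_deriv_cmult:
  fixes c :: real
  assumes "weak_deriv f f'"
  shows "weak_deriv (\<lambda>x. c * f x) (\<lambda>x. c * f' x)"
  using assms unfolding weak_deriv_def by (auto simp: algebra_simps simp flip: right_diff_distrib)

lemma weak_deriv_ident: "weak_deriv (\<lambda>x. x) (\<lambda>x. 1)"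
  unfolding weak_deriv_def by (auto simp: set_integrable_def set_lebesgue_integral_def)

lemma weak_deriv_nonneg_imp_mono:
  assumes "weak_deriv f g" and "AE x in lborel. 0 \<le> g x" and "a \<le> b"
  shows "f a \<le> f b"
proof -
  have "0 \<le> (LINT x:{a..b}|lborel. g x)"
    unfolding set_lebesgue_integral_def
    using assms(2) by (intro integral_nonneg_AE) (auto simp: indicator_def)
  then show ?thesis
    using assms(1,3) unfolding weak_deriv_def by force
qed

lemma weak_deriv_imp_continuous_right:
  assumes "weak_deriv f g" and "0 < e"
  obtains d where "0 < d" "\<And>x. a \<le> x \<Longrightarrow> x \<le> a + d \<Longrightarrow> \<bar>f x - f a\<bar> < e"
proof -
  have *: "g integrable_on {a..a+1}" "\<And>x. a \<le> x \<Longrightarrow> f x - f a = integral {a..x} g"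
    using assms(1) unfolding weak_deriv_def
    by (metis set_borel_integral_eq_integral le_add_same_cancel1 zero_le_one)+
  have "continuous_on {a..a+1} (\<lambda>x. integral {a..x} g)"
    by (rule indefinite_integral_continuous_1[OF *(1)])
  then obtain d where "0 < d"
    and d: "\<And>x. x \<in> {a..a+1} \<Longrightarrow> dist x a < d \<Longrightarrow> dist (integral {a..x} g) (integral {a..a} g) < e"
    using assms(2) unfolding continuous_on_iff
    by (metis atLeastAtMost_iff le_add_same_cancel1 order_refl zero_le_one)
  show ?thesis
  proof (rule that[of "min 1 (d/2)"])
    fix x assume "a \<le> x" "x \<le> a + min 1 (d/2)"
    then show "\<bar>f x - f a\<bar> < e"
      using d[of x] *(2)[of x] \<open>0 < d\<close> by (auto simp: dist_real_def)
  qed (use \<open>0 < d\<close> in auto)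
qed

text \<open>At almost every point the mean values of an integrable function over short intervals to the
  right of the point converge to its value. Here these means are difference quotients of \<open>f\<close>.\<close>

lemma mono_imp_weak_deriv_nonneg:
  assumes wd: "weak_deriv f g"
    and mono: "\<And>x y. p < x \<Longrightarrow> x \<le> y \<Longrightarrow> y < q \<Longrightarrow> f x \<le> f y"
  shows "AE x in lborel. p < x \<and> x < q \<longrightarrow> 0 \<le> g x"
proof -
  have int: "g integrable_on cbox a b" for a b
    using wd unfolding weak_deriv_def
    by (cases "a \<le> b") (auto dest: set_borel_integral_eq_integral(1))
  have eq: "integral {a..b} g = f b - f a" if "a \<le> b" for a b
    using wd that unfolding weak_deriv_def by (simp flip: set_borel_integral_eq_integral(2))
  obtain N where "negligible N"
    and N: "\<And>x e. x \<notin> N \<Longrightarrow> 0 < e \<Longrightarrow>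
      \<exists>d>0. \<forall>h. 0 < h \<and> h < d \<longrightarrow>
        norm (integral (cbox x (x + h *\<^sub>R One)) g /\<^sub>R h ^ DIM(real) - g x) < e"
    using integrable_ccontinuous_explicit[OF int] by blast
  have nn: "0 \<le> g x" if x: "x \<notin> N" "p < x" "x < q" for x
  proof (rule ccontr)
    assume "\<not> 0 \<le> g x"
    then obtain d where "0 < d" and d: "\<And>h. 0 < h \<Longrightarrow> h < d \<Longrightarrow>
        \<bar>integral {x..x + h} g / h - g x\<bar> < - g x"
      using N[OF x(1), of "- g x"] by (auto simp: divide_inverse mult.commute)
    define h where "h = min (d/2) ((q-x)/2)"
    have "0 < h" "h < d" "x + h < q"
      using \<open>0 < d\<close> x unfolding h_def min_def by (auto simp: field_simps)
    moreover have "0 \<le> integral {x..x + h} g / h"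
      using mono[of x "x+h"] eq[of x "x+h"] x \<open>0 < h\<close> \<open>x + h < q\<close> by simp
    ultimately show False
      using d[of h] by linarith
  qed
  have "AE x in lebesgue. x \<notin> N"
    using \<open>negligible N\<close> negligible_iff_null_sets AE_not_in by blast
  then have "AE x in lborel. x \<notin> N"
    by (simp add: AE_completion_iff)
  then show ?thesis
    by eventually_elim (use nn in blast)
qed

section \<open>A comparison argument for the reciprocal slope\<close>

text \<open>The functions \<open>a\<close>, \<open>b\<close>, \<open>h\<close> stand for \<open>y\<^sub>\<xi>\<close>, \<open>U\<^sub>\<xi>\<close>, \<open>h\<close> at one label, and \<open>V\<close> for \<open>U\<^sup>2\<close>. The sign
  of \<open>P\<close> is used twice. Since \<open>b \<le> 0\<close>, it bounds \<open>h'\<close> from below by \<open>-2 C e h\<close>, which keeps \<open>h\<close>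
  positive, so that \<open>b / h\<close> is defined. It then bounds the derivative
  \<open>1/2 + (P - V) (b / h)\<^sup>2\<close> of \<open>b / h\<close> from below by \<open>1/4\<close>, while \<open>b / h\<close> has to stay in
  \<open>[-e, 0]\<close> over a time longer than \<open>4 e\<close>.\<close>

lemma reciprocal_slope_contradiction:
  fixes a b h P V :: "real \<Rightarrow> real"
  assumes "0 < e" and "C * e\<^sup>2 \<le> 1/4" and "4 * e < S - T"
    and cont: "continuous_on {T..S} b" "continuous_on {T..S} h"
    and db: "\<And>t. T < t \<Longrightarrow> t < S \<Longrightarrow> (b has_real_derivative 1/2 * h t + (V t - P t) * a t) (at t)"
    and dh: "\<And>t. T < t \<Longrightarrow> t < S \<Longrightarrow> (h has_real_derivative 2 * (V t - P t) * b t) (at t)"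
    and nonneg: "\<And>t. t \<in> {T..S} \<Longrightarrow> 0 \<le> a t" "\<And>t. t \<in> {T..S} \<Longrightarrow> 0 \<le> h t"
    and quad: "\<And>t. t \<in> {T..S} \<Longrightarrow> a t * h t = (b t)\<^sup>2"
    and steep: "\<And>t. t \<in> {T..S} \<Longrightarrow> a t \<le> - e * b t"
    and P: "\<And>t. t \<in> {T..S} \<Longrightarrow> 0 \<le> P t"
    and V: "\<And>t. t \<in> {T..S} \<Longrightarrow> 0 \<le> V t \<and> V t \<le> C"
    and "0 < h T"
  shows False
proof -
  have "T < S" using assms(1,3) by linarith
  have b_nonpos: "b t \<le> 0" if "t \<in> {T..S}" for t
    using order_trans[OF nonneg(1) steep, OF that that] \<open>0 < e\<close> by (simp add: mult_le_0_iff)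
  \<comment> \<open>Multiplying \<open>a \<le> - e b\<close> by \<open>h\<close> turns \<open>b\<^sup>2 = a h\<close> into \<open>\<bar>b\<bar> \<le> e h\<close>.\<close>
  have b_lower: "- e * h t \<le> b t" if t: "t \<in> {T..S}" for t
  proof (cases "a t = 0")
    case True
    then show ?thesis
      using quad[OF t] nonneg(2)[OF t] \<open>0 < e\<close> by simp
  next
    case False
    with nonneg(1)[OF t] have "0 < a t" by simp
    have "(- b t) * (- b t) = a t * h t"
      using quad[OF t] by (simp add: power2_eq_square)
    also have "\<dots> \<le> (e * (- b t)) * h t"
      using steep[OF t] nonneg(2)[OF t] by (intro mult_right_mono) auto
    finally have "(- b t) * (- b t) \<le> (- b t) * (e * h t)"
      by (simp only: mult_ac)
    moreover have "0 < - b t"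
      using \<open>0 < a t\<close> steep[OF t] \<open>0 < e\<close> b_nonpos[OF t] by (cases "b t = 0") auto
    ultimately have "- b t \<le> e * h t" by (rule mult_left_le_imp_le)
    then show ?thesis by simp
  qed
  define K where "K = 2 * C * e"
  have h_pos: "0 < h t" if t: "t \<in> {T..S}" for t
  proof -
    have "h T * exp (K * T) \<le> h t * exp (K * t)"
    proof (rule DERIV_nonneg_imp_increasing_open[where f = "\<lambda>x. h x * exp (K * x)"])
      fix x assume x: "T < x" "x < t"
      then have xi: "x \<in> {T..S}" using t by auto
      have "((\<lambda>x. h x * exp (K * x)) has_real_derivative
          exp (K * x) * (2 * (V x - P x) * b x + K * h x)) (at x)"
        using x t by (auto intro!: derivative_eq_intros dh simp: algebra_simps)
      moreover have "- (K * h x) \<le> 2 * (V x - P x) * b x"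
      proof -
        have "C * (- b x) \<le> C * (e * h x)"
          using b_lower[OF xi] V[OF xi] by (intro mult_left_mono) auto
        moreover have "V x * (- b x) \<le> C * (- b x)"
          using V[OF xi] b_nonpos[OF xi] by (intro mult_right_mono) auto
        moreover have "0 \<le> P x * (- b x)"
          using P[OF xi] b_nonpos[OF xi] by (intro mult_nonneg_nonneg) auto
        ultimately show ?thesis
          unfolding K_def by (simp add: algebra_simps)
      qed
      ultimately show "\<exists>y. ((\<lambda>x. h x * exp (K * x)) has_real_derivative y) (at x) \<and> 0 \<le> y"
        by - (intro exI conjI, assumption, simp)
    next
      show "continuous_on {T..t} (\<lambda>x. h x * exp (K * x))"
        using t by (intro continuous_intros continuous_on_subset[OF cont(2)]) auto
    qed (use t in auto)
    moreover have "0 < h T * exp (K * T)" using \<open>0 < h T\<close> by simp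
    ultimately have "0 < h t * exp (K * t)" by linarith
    then show ?thesis by (simp add: zero_less_mult_iff)
  qed
  have "b T / h T - T/4 \<le> b S / h S - S/4"
  proof (rule DERIV_nonneg_imp_increasing_open[where f = "\<lambda>x. b x / h x - x/4"])
    fix x assume x: "T < x" "x < S"
    then have xi: "x \<in> {T..S}" by auto
    have hx: "0 < h x" by (rule h_pos[OF xi])
    let ?N = "(1/2 * h x + (V x - P x) * a x) * h x - b x * (2 * (V x - P x) * b x)"
    have "((\<lambda>x. b x / h x - x/4) has_real_derivative ?N / (h x * h x) - 1/4) (at x)"
      using hx by (auto intro!: derivative_eq_intros db[OF x] dh[OF x])
    moreover have "1/4 \<le> ?N / (h x * h x)"
    proof -
      have N: "?N = (h x)\<^sup>2 / 2 + (P x - V x) * (b x)\<^sup>2"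
      proof -
        have "?N = (h x)\<^sup>2 / 2 + (V x - P x) * (a x * h x) - 2 * (V x - P x) * (b x)\<^sup>2"
          by (simp add: algebra_simps power2_eq_square)
        then show ?thesis
          unfolding quad[OF xi] by (simp add: algebra_simps)
      qed
      have "(b x)\<^sup>2 \<le> (e * h x)\<^sup>2"
        using b_lower[OF xi] b_nonpos[OF xi] by (subst power2_minus[symmetric], intro power_mono) auto
      then have "V x * (b x)\<^sup>2 \<le> C * (e\<^sup>2 * (h x)\<^sup>2)"
        using V[OF xi] by (intro mult_mono) (auto simp: power_mult_distrib)
      also have "\<dots> \<le> 1/4 * (h x)\<^sup>2"
        using mult_right_mono[OF assms(2), of "(h x)\<^sup>2"] by (simp add: mult.assoc)
      finally have "V x * (b x)\<^sup>2 \<le> 1/4 * (h x)\<^sup>2" .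
      moreover have "0 \<le> P x * (b x)\<^sup>2"
        using P[OF xi] by simp
      ultimately have "(h x)\<^sup>2 / 4 \<le> ?N"
        unfolding N unfolding left_diff_distrib by linarith
      then show ?thesis
        using hx by (simp add: field_simps power2_eq_square)
    qed
    ultimately show "\<exists>y. ((\<lambda>x. b x / h x - x/4) has_real_derivative y) (at x) \<and> 0 \<le> y"
      by - (intro exI conjI, assumption, simp)
  next
    have "h x \<noteq> 0" if "x \<in> {T..S}" for x
      using h_pos[OF that] by simp
    then show "continuous_on {T..S} (\<lambda>x. b x / h x - x/4)"
      by (intro continuous_intros cont) auto
  qed (use \<open>T < S\<close> in simp)
  moreover have "b S / h S \<le> 0"
    using b_nonpos[of S] h_pos[of S] \<open>T < S\<close> by (simp add: divide_nonpos_pos)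
  moreover have "- e \<le> b T / h T"
    using b_lower[of T] \<open>0 < h T\<close> \<open>T < S\<close> by (simp add: field_simps)
  ultimately show False
    using assms(3) by linarith
qed

section \<open>The cuspon near its crest\<close>

lemma cuspon_profile_decreasing:
  assumes "cuspon_profile m s M \<phi>" and "0 \<le> x" and "x < y"
  shows "\<phi> y < \<phi> x"
proof (rule DERIV_neg_imp_decreasing_open[OF \<open>x < y\<close>])
  fix z assume "x < z" "z < y"
  then show "\<exists>d. (\<phi> has_real_derivative d) (at z) \<and> d < 0"
    using assms unfolding cuspon_profile_def
    by (intro exI[of _ "deriv \<phi> z"]) (auto simp: DERIV_deriv_iff_field_differentiable)
next
  show "continuous_on {x..y} \<phi>"
    using assms(1) unfolding cuspon_profile_def by (auto intro: continuous_on_subset)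
qed

lemma cuspon_profile_le_crest:
  assumes "cuspon_profile m s M \<phi>"
  shows "\<phi> x \<le> s"
proof -
  have "\<phi> \<bar>x\<bar> = \<phi> x" "\<phi> 0 = s"
    using assms unfolding cuspon_profile_def by (auto simp: abs_if)
  then show ?thesis
    using cuspon_profile_decreasing[OF assms, of 0 "\<bar>x\<bar>"] by (cases "x = 0") auto
qed

text \<open>The profile equation gives \<open>\<phi>'\<^sup>2 = (M - \<phi>) (\<phi> - m)\<^sup>2 / (s - \<phi>)\<close>, which tends to infinity at the
  crest because \<open>\<phi>\<close> tends to \<open>s\<close> there while the numerator stays away from zero. The estimate is stated
  for differences, including those from the crest itself, where \<open>\<phi>\<close> has no derivative. Between
  two labels it compares the increments of \<open>y\<close> and \<open>U\<close>, even if the labels share one position.\<close>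

lemma cuspon_profile_steep_at_crest:
  assumes c: "cuspon_profile m s M \<phi>" and "m < s" "s < M" and "0 < e"
  obtains d where "0 < d"
    "\<And>x. 0 \<le> x \<Longrightarrow> x \<le> d \<Longrightarrow> m \<le> \<phi> x"
    "\<And>x y. 0 \<le> x \<Longrightarrow> x \<le> y \<Longrightarrow> y \<le> d \<Longrightarrow> y - x \<le> e * (\<phi> x - \<phi> y)"
proof -
  have cont: "continuous_on UNIV \<phi>" and "\<phi> 0 = s"
    using c unfolding cuspon_profile_def by auto
  \<comment> \<open>\<open>K\<close> bounds the numerator from below wherever \<open>l \<le> \<phi> \<le> s\<close>.\<close>
  define l where "l = (m + s) / 2"
  define K where "K = (M - s) * (l - m)\<^sup>2"
  have "m < l" "l < s" "0 < K"
    using assms(2,3) unfolding l_def K_def by (auto simp: field_simps)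
  define r where "r = min (s - l) (K * e\<^sup>2)"
  have "0 < r" using \<open>l < s\<close> \<open>0 < K\<close> \<open>0 < e\<close> unfolding r_def by auto
  have "\<exists>d>0. \<forall>x. dist x 0 < d \<longrightarrow> dist (\<phi> x) (\<phi> 0) < r"
    using cont \<open>0 < r\<close> unfolding continuous_on_iff by blast
  then obtain d where "0 < d" and d: "\<And>x. \<bar>x\<bar> < d \<Longrightarrow> \<bar>\<phi> x - s\<bar> < r"
    using \<open>\<phi> 0 = s\<close> by (auto simp: dist_real_def)
  have slope: "1/e \<le> - deriv \<phi> x" if "0 < x" "x < d" for x
  proof -
    have "\<phi> x < s"
      using cuspon_profile_decreasing[OF c, of 0 x] that \<open>\<phi> 0 = s\<close> by simp
    have near: "s - \<phi> x < s - l" "s - \<phi> x < K * e\<^sup>2"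
      using d[of x] that unfolding r_def by auto
    have dsq: "(deriv \<phi> x)\<^sup>2 = (M - \<phi> x) * (\<phi> x - m)\<^sup>2 / (s - \<phi> x)" and "deriv \<phi> x < 0"
      using c that unfolding cuspon_profile_def by auto
    have "K \<le> (M - \<phi> x) * (\<phi> x - m)\<^sup>2"
      unfolding K_def using near(1) \<open>\<phi> x < s\<close> \<open>m < l\<close> \<open>s < M\<close>
      by (intro mult_mono power_mono) auto
    moreover have "(1/e)\<^sup>2 * (s - \<phi> x) \<le> K"
      using near(2) \<open>0 < e\<close> by (simp add: field_simps)
    ultimately have "(1/e)\<^sup>2 \<le> (- deriv \<phi> x)\<^sup>2"
      using \<open>\<phi> x < s\<close> unfolding power2_minus dsq by (simp add: pos_le_divide_eq)
    then show ?thesis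
      using \<open>deriv \<phi> x < 0\<close> by - (erule power2_le_imp_le, simp)
  qed
  show ?thesis
  proof (rule that[of "d/2"])
    fix x assume "0 \<le> x" "x \<le> d/2"
    then show "m \<le> \<phi> x"
      using d[of x] \<open>0 < d\<close> \<open>m < l\<close> unfolding r_def by auto
  next
    fix x y assume xy: "0 \<le> x" "x \<le> y" "y \<le> d/2"
    have "- \<phi> x - x/e \<le> - \<phi> y - y/e"
    proof (rule DERIV_nonneg_imp_increasing_open[OF \<open>x \<le> y\<close>, where f = "\<lambda>x. - \<phi> x - x/e"])
      fix z assume z: "x < z" "z < y"
      then have "(\<phi> has_real_derivative deriv \<phi> z) (at z)"
        using c xy unfolding cuspon_profile_def by (auto simp: DERIV_deriv_iff_field_differentiable)
      then have "((\<lambda>x. - \<phi> x - x/e) has_real_derivative - deriv \<phi> z - 1/e) (at z)"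
        using \<open>0 < e\<close> by (auto intro!: derivative_eq_intros)
      then show "\<exists>D. ((\<lambda>x. - \<phi> x - x/e) has_real_derivative D) (at z) \<and> 0 \<le> D"
        using slope[of z] z xy \<open>0 < d\<close> by - (intro exI conjI, assumption, auto)
    next
      show "continuous_on {x..y} (\<lambda>x. - \<phi> x - x/e)"
        using \<open>0 < e\<close> by (intro continuous_intros continuous_on_subset[OF cont]) auto
    qed
    then have "(y - x) / e \<le> \<phi> x - \<phi> y"
      by (simp add: diff_divide_distrib)
    then show "y - x \<le> e * (\<phi> x - \<phi> y)"
      using \<open>0 < e\<close> by (simp add: pos_divide_le_eq mult.commute)
  qed (use \<open>0 < d\<close> in auto)
qed

section \<open>Characteristics at the cusp\<close>

lemma lagrangian_P_nonneg:
  assumes "lagrangian_set c (\<zeta> t) (U t) (h t) (\<zeta>\<xi> t) (U\<xi> t)"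
  shows "0 \<le> lagrangian_P \<zeta> U h \<zeta>\<xi> t \<xi>"
proof -
  have "AE \<eta> in lborel. 0 \<le> 1 + \<zeta>\<xi> t \<eta> \<and> 0 \<le> h t \<eta>"
    using assms unfolding lagrangian_set_def by (auto elim: AE_mp)
  then have "AE \<eta> in lborel. 0 \<le> exp (- \<bar>characteristic \<zeta> t \<xi> - characteristic \<zeta> t \<eta>\<bar>) *
        (2 * (U t \<eta>)\<^sup>2 * (1 + \<zeta>\<xi> t \<eta>) + h t \<eta>)"
  proof eventually_elim
    case (elim \<eta>)
    then have "0 \<le> 2 * (U t \<eta>)\<^sup>2 * (1 + \<zeta>\<xi> t \<eta>)"
      by (intro mult_nonneg_nonneg) auto
    with elim show ?case by simp
  qed
  then show ?thesis
    unfolding lagrangian_P_def by (simp add: integral_nonneg_AE)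
qed

text \<open>In particular energy is present at almost every label of the steep region: where \<open>h = 0\<close>, the
  relation \<open>y\<^sub>\<xi> h = U\<^sub>\<xi>\<^sup>2\<close> gives \<open>U\<^sub>\<xi> = 0\<close>, the steepness gives \<open>y\<^sub>\<xi> \<le> 0\<close>, and this contradicts
  \<open>y\<^sub>\<xi> + h > 0\<close>.\<close>

lemma lagrangian_set_slopes:
  assumes L: "lagrangian_set c \<zeta> U h \<zeta>\<xi> U\<xi>" and "0 < e"
    and steep: "\<And>x y. p < x \<Longrightarrow> x \<le> y \<Longrightarrow> y < q \<Longrightarrow> (y + \<zeta> y) - (x + \<zeta> x) \<le> e * (U x - U y)"
  shows "AE \<xi> in lborel. p < \<xi> \<and> \<xi> < q \<longrightarrow>
    0 \<le> 1 + \<zeta>\<xi> \<xi> \<and> 0 \<le> h \<xi> \<and> (1 + \<zeta>\<xi> \<xi>) * h \<xi> = (U\<xi> \<xi>)\<^sup>2 \<and>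
    1 + \<zeta>\<xi> \<xi> \<le> - e * U\<xi> \<xi> \<and> 0 < h \<xi>"
proof -
  have wd: "weak_deriv \<zeta> \<zeta>\<xi>" "weak_deriv U U\<xi>"
    and ae: "AE \<xi> in lborel. 1 + \<zeta>\<xi> \<xi> \<ge> 0 \<and> h \<xi> \<ge> 0 \<and> (1 + \<zeta>\<xi> \<xi>) + h \<xi> > 0 \<and>
        (1 + \<zeta>\<xi> \<xi>) * h \<xi> = (U\<xi> \<xi>)\<^sup>2"
    using L unfolding lagrangian_set_def by auto
  have "weak_deriv (\<lambda>x. (-1) * (x + \<zeta> x) + (- e) * U x) (\<lambda>x. (-1) * (1 + \<zeta>\<xi> x) + (- e) * U\<xi> x)"
    by (intro weak_deriv_add weak_deriv_cmult weak_deriv_ident wd)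
  then have "AE \<xi> in lborel. p < \<xi> \<and> \<xi> < q \<longrightarrow> 0 \<le> (-1) * (1 + \<zeta>\<xi> \<xi>) + (- e) * U\<xi> \<xi>"
  proof (rule mono_imp_weak_deriv_nonneg)
    fix x y assume "p < x" "x \<le> y" "y < q"
    then show "(-1) * (x + \<zeta> x) + (- e) * U x \<le> (-1) * (y + \<zeta> y) + (- e) * U y"
      using steep[of x y] by (simp add: algebra_simps)
  qed
  with ae show ?thesis
  proof eventually_elim
    case (elim \<xi>)
    have "0 < h \<xi>" if "1 + \<zeta>\<xi> \<xi> \<le> - e * U\<xi> \<xi>"
    proof (rule ccontr)
      assume "\<not> 0 < h \<xi>"
      then have "h \<xi> = 0" "U\<xi> \<xi> = 0" using elim by auto
      then show False using elim that by auto
    qed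
    with elim show ?case by auto
  qed
qed

text \<open>The pointwise relations in the Lagrangian set hold at each time outside a null set of labels that
  may depend on the time. Imposing them at rational times only keeps a single null set, and
  continuity in time along a label recovers them at all times.\<close>

lemma nonneg_from_rationals:
  fixes f :: "real \<Rightarrow> real"
  assumes "T < S" and "continuous_on {T..S} f"
    and "\<And>t. t \<in> \<rat> \<Longrightarrow> T < t \<Longrightarrow> t < S \<Longrightarrow> 0 \<le> f t"
    and "t \<in> {T..S}"
  shows "0 \<le> f t"
proof -
  have cl: "closure ({T<..<S} \<inter> \<rat>) = {T..S}"
    using \<open>T < S\<close> by (subst closure_open_Int_superset) (auto simp: Rats_closure_real)
  show ?thesis
    by (rule continuous_ge_on_closure[where S = "{T<..<S} \<inter> \<rat>"]) (use assms cl in auto)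
qed

text \<open>If \<open>\<xi>\<^sub>0\<close> stays on the cusp, it acts as a barrier that keeps the labels in some \<open>(\<xi>\<^sub>0, q)\<close> in the
  steep region during \<open>[T,S]\<close>, and \<open>reciprocal_slope_contradiction\<close> applies at almost each of them.
  Only labels to the right of \<open>\<xi>\<^sub>0\<close> lead to a contradiction: to its left \<open>u\<close> increases, and the growth of \<open>U\<^sub>\<xi> / h\<close> is no obstruction.\<close>

lemma characteristic_leaves_cusp:
  fixes m s M \<kappa> :: real
  assumes "m < s" "s < M"
    and c: "cuspon_profile m s M \<phi>"
    and sol: "lagrangian_solution k \<zeta> U h \<zeta>\<xi> U\<xi>"
    and wave: "\<And>t \<xi>. 0 \<le> t \<Longrightarrow> \<phi> (characteristic \<zeta> t \<xi> - (s + \<kappa>) * t) + \<kappa> = U t \<xi>"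
    and "0 \<le> T" and start: "characteristic \<zeta> T \<xi>\<^sub>0 = (s + \<kappa>) * T" and "T < S"
  shows "characteristic \<zeta> S \<xi>\<^sub>0 < (s + \<kappa>) * S"
proof (rule ccontr)
  assume late: "\<not> ?thesis"
  define z where "z t \<xi> = characteristic \<zeta> t \<xi> - (s + \<kappa>) * t" for t \<xi>
  have L: "lagrangian_set k (\<zeta> t) (U t) (h t) (\<zeta>\<xi> t) (U\<xi> t)" if "0 \<le> t" for t
    using sol that unfolding lagrangian_solution_def by auto
  have d\<zeta>: "((\<lambda>\<tau>. \<zeta> \<tau> \<xi>) has_real_derivative U t \<xi>) (at t within {0..})" if "0 \<le> t" for t \<xi>
    using sol that unfolding lagrangian_solution_def by auto
  have Uz: "U t \<xi> = \<phi> (z t \<xi>) + \<kappa>" if "0 \<le> t" for t \<xi>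
    using wave[OF that, of \<xi>] unfolding z_def by simp
  have antimono: "z t' \<xi> \<le> z t \<xi>" if "0 \<le> t" "t \<le> t'" for t t' \<xi>
  proof -
    have dz: "((\<lambda>\<tau>. - z \<tau> \<xi>) has_real_derivative s - \<phi> (z x \<xi>)) (at x within {0..})" if "0 \<le> x" for x
      unfolding z_def characteristic_def using Uz[OF that, of \<xi>]
      by (auto intro!: derivative_eq_intros d\<zeta>[OF that] simp: z_def characteristic_def)
    have "- z t \<xi> \<le> - z t' \<xi>"
    proof (rule DERIV_nonneg_imp_increasing_open[OF \<open>t \<le> t'\<close>, where f = "\<lambda>\<tau>. - z \<tau> \<xi>"])
      fix x assume "t < x" "x < t'"
      then have "(at x within {0..}) = at x"
        using \<open>0 \<le> t\<close> by (intro at_within_interior) auto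
      then show "\<exists>y. ((\<lambda>\<tau>. - z \<tau> \<xi>) has_real_derivative y) (at x) \<and> 0 \<le> y"
        using dz[of x] cuspon_profile_le_crest[OF c, of "z x \<xi>"] \<open>0 \<le> t\<close> \<open>t < x\<close>
        by (auto intro: exI[of _ "s - \<phi> (z x \<xi>)"])
    next
      show "continuous_on {t..t'} (\<lambda>\<tau>. - z \<tau> \<xi>)"
        using that(1) by (intro DERIV_continuous_on[OF has_field_derivative_subset[OF dz]]) auto
    qed
    then show ?thesis by simp
  qed
  have mono: "z t x \<le> z t y" if "0 \<le> t" "x \<le> y" for t x y
  proof -
    have "weak_deriv (\<lambda>\<xi>. \<xi> + \<zeta> t \<xi>) (\<lambda>\<xi>. 1 + \<zeta>\<xi> t \<xi>)"
      using L[OF that(1)] unfolding lagrangian_set_def by (intro weak_deriv_add weak_deriv_ident) auto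
    moreover have "AE \<xi> in lborel. 0 \<le> 1 + \<zeta>\<xi> t \<xi>"
      using L[OF that(1)] unfolding lagrangian_set_def by (auto elim: AE_mp)
    ultimately show ?thesis
      using weak_deriv_nonneg_imp_mono[OF _ _ that(2)] unfolding z_def characteristic_def by force
  qed
  have "z T \<xi>\<^sub>0 = 0" "0 \<le> z S \<xi>\<^sub>0"
    using start late unfolding z_def by auto

  \<comment> \<open>\<open>C\<close> bounds \<open>U\<^sup>2\<close> where \<open>m \<le> \<phi> \<le> s\<close>. The first entry of the minimum makes \<open>4 e < S - T\<close>, the
    second makes \<open>C e\<^sup>2 \<le> 1/4\<close>.\<close>
  define C where "C = (\<bar>m\<bar> + \<bar>s\<bar> + \<bar>\<kappa>\<bar>)\<^sup>2"
  define e where "e = min ((S - T) / 8) (1 / (2 * (1 + \<bar>m\<bar> + \<bar>s\<bar> + \<bar>\<kappa>\<bar>)))"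
  have "0 < e"
    using \<open>T < S\<close> unfolding e_def by auto
  have "e \<le> (S - T) / 8"
    unfolding e_def by (rule min.cobounded1)
  then have "4 * e < S - T"
    using \<open>T < S\<close> by simp
  have "C * e\<^sup>2 \<le> 1/4"
  proof -
    have "(\<bar>m\<bar> + \<bar>s\<bar> + \<bar>\<kappa>\<bar>) * e \<le> (1 + \<bar>m\<bar> + \<bar>s\<bar> + \<bar>\<kappa>\<bar>) * (1 / (2 * (1 + \<bar>m\<bar> + \<bar>s\<bar> + \<bar>\<kappa>\<bar>)))"
      unfolding e_def using \<open>0 < e\<close> e_def by (intro mult_mono) auto
    also have "\<dots> = 1/2"
      by (simp add: add_nonneg_eq_0_iff field_simps)
    finally have "((\<bar>m\<bar> + \<bar>s\<bar> + \<bar>\<kappa>\<bar>) * e)\<^sup>2 \<le> (1/2)\<^sup>2"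
      using \<open>0 < e\<close> by (intro power_mono) auto
    moreover have "(1/2 :: real)\<^sup>2 = 1/4"
      by (simp add: power2_eq_square)
    ultimately show ?thesis
      unfolding C_def power_mult_distrib by (simp only:)
  qed
  obtain d where "0 < d"
    and above_m: "\<And>x. 0 \<le> x \<Longrightarrow> x \<le> d \<Longrightarrow> m \<le> \<phi> x"
    and steep: "\<And>x y. 0 \<le> x \<Longrightarrow> x \<le> y \<Longrightarrow> y \<le> d \<Longrightarrow> y - x \<le> e * (\<phi> x - \<phi> y)"
    using cuspon_profile_steep_at_crest[OF c \<open>m < s\<close> \<open>s < M\<close> \<open>0 < e\<close>] by blast
  obtain q where "\<xi>\<^sub>0 < q" and q: "\<And>\<xi>. \<xi>\<^sub>0 < \<xi> \<Longrightarrow> \<xi> < q \<Longrightarrow> z T \<xi> \<le> d"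
  proof -
    have "weak_deriv (\<lambda>\<xi>. \<xi> + \<zeta> T \<xi>) (\<lambda>\<xi>. 1 + \<zeta>\<xi> T \<xi>)"
      using L[OF \<open>0 \<le> T\<close>] unfolding lagrangian_set_def by (intro weak_deriv_add weak_deriv_ident) auto
    then obtain r where "0 < r"
      and r: "\<And>x. \<xi>\<^sub>0 \<le> x \<Longrightarrow> x \<le> \<xi>\<^sub>0 + r \<Longrightarrow> \<bar>(x + \<zeta> T x) - (\<xi>\<^sub>0 + \<zeta> T \<xi>\<^sub>0)\<bar> < d"
      using weak_deriv_imp_continuous_right[OF _ \<open>0 < d\<close>, of _ _ \<xi>\<^sub>0] by blast
    show ?thesis
    proof (rule that[of "\<xi>\<^sub>0 + r"])
      fix \<xi> assume "\<xi>\<^sub>0 < \<xi>" "\<xi> < \<xi>\<^sub>0 + r"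
      then show "z T \<xi> \<le> d"
        using r[of \<xi>] \<open>z T \<xi>\<^sub>0 = 0\<close> unfolding z_def characteristic_def by auto
    qed (use \<open>0 < r\<close> in auto)
  qed
  have near: "0 \<le> z t \<xi> \<and> z t \<xi> \<le> d" if "t \<in> {T..S}" "\<xi>\<^sub>0 < \<xi>" "\<xi> < q" for t \<xi>
  proof -
    have "0 \<le> z S \<xi>\<^sub>0" by fact
    also have "\<dots> \<le> z t \<xi>\<^sub>0" using that \<open>0 \<le> T\<close> by (intro antimono) auto
    also have "\<dots> \<le> z t \<xi>" using that \<open>0 \<le> T\<close> by (intro mono) auto
    finally have "0 \<le> z t \<xi>" .
    moreover have "z t \<xi> \<le> z T \<xi>" using that \<open>0 \<le> T\<close> by (intro antimono) auto
    ultimately show ?thesis using q[OF that(2,3)] by linarith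
  qed

  have slopes: "AE \<xi> in lborel. \<xi>\<^sub>0 < \<xi> \<and> \<xi> < q \<longrightarrow>
      0 \<le> 1 + \<zeta>\<xi> t \<xi> \<and> 0 \<le> h t \<xi> \<and> (1 + \<zeta>\<xi> t \<xi>) * h t \<xi> = (U\<xi> t \<xi>)\<^sup>2 \<and>
      1 + \<zeta>\<xi> t \<xi> \<le> - e * U\<xi> t \<xi> \<and> 0 < h t \<xi>" if t: "t \<in> {T..S}" for t
  proof (rule lagrangian_set_slopes[OF L \<open>0 < e\<close>])
    show "0 \<le> t" using t \<open>0 \<le> T\<close> by simp
    fix x y assume xy: "\<xi>\<^sub>0 < x" "x \<le> y" "y < q"
    have "z t y - z t x \<le> e * (\<phi> (z t x) - \<phi> (z t y))"
      using near[OF t, of x] near[OF t, of y] mono[OF \<open>0 \<le> t\<close> xy(2)] xy by (intro steep) auto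
    then show "(y + \<zeta> t y) - (x + \<zeta> t x) \<le> e * (U t x - U t y)"
      unfolding Uz[OF \<open>0 \<le> t\<close>] by (simp add: z_def characteristic_def)
  qed
  \<comment> \<open>\<open>T\<close> need not be rational, and the strict inequality \<open>h > 0\<close> is needed there, which does not
    follow by continuity.\<close>
  let ?D = "insert T (\<rat> \<inter> {T..S})"
  have "AE \<xi> in lborel. \<forall>t\<in>?D. \<xi>\<^sub>0 < \<xi> \<and> \<xi> < q \<longrightarrow>
      0 \<le> 1 + \<zeta>\<xi> t \<xi> \<and> 0 \<le> h t \<xi> \<and> (1 + \<zeta>\<xi> t \<xi>) * h t \<xi> = (U\<xi> t \<xi>)\<^sup>2 \<and>
      1 + \<zeta>\<xi> t \<xi> \<le> - e * U\<xi> t \<xi> \<and> 0 < h t \<xi>"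
    using \<open>T < S\<close> slopes by (subst AE_ball_countable) (auto intro: countable_Int1 countable_rat)
  moreover have "AE \<xi> in lborel. \<forall>t\<ge>0.
        ((\<lambda>\<tau>. \<zeta>\<xi> \<tau> \<xi>) has_real_derivative U\<xi> t \<xi>) (at t within {0..}) \<and>
        ((\<lambda>\<tau>. U\<xi> \<tau> \<xi>) has_real_derivative
           1/2 * h t \<xi> + ((U t \<xi>)\<^sup>2 - lagrangian_P \<zeta> U h \<zeta>\<xi> t \<xi>) * (1 + \<zeta>\<xi> t \<xi>))
           (at t within {0..}) \<and>
        ((\<lambda>\<tau>. h \<tau> \<xi>) has_real_derivative
           2 * ((U t \<xi>)\<^sup>2 - lagrangian_P \<zeta> U h \<zeta>\<xi> t \<xi>) * U\<xi> t \<xi>) (at t within {0..})"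
    using sol unfolding lagrangian_solution_def by blast
  ultimately have "AE \<xi> in lborel. \<not> (\<xi>\<^sub>0 < \<xi> \<and> \<xi> < q)"
  proof eventually_elim
    case (elim \<xi>)
    show ?case
    proof
      assume \<xi>: "\<xi>\<^sub>0 < \<xi> \<and> \<xi> < q"
      define a where "a t = 1 + \<zeta>\<xi> t \<xi>" for t
      define b where "b t = U\<xi> t \<xi>" for t
      define g where "g t = h t \<xi>" for t
      define V where "V t = (U t \<xi>)\<^sup>2" for t
      define P where "P t = lagrangian_P \<zeta> U h \<zeta>\<xi> t \<xi>" for t
      have der: "(a has_real_derivative b t) (at t within {0..})"
          "(b has_real_derivative 1/2 * g t + (V t - P t) * a t) (at t within {0..})"
          "(g has_real_derivative 2 * (V t - P t) * b t) (at t within {0..})" if "0 \<le> t" for t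
        using elim(2) that unfolding a_def b_def g_def V_def P_def
        by (auto intro!: derivative_eq_intros)
      have sub: "{T..S} \<subseteq> {0..}" using \<open>0 \<le> T\<close> by auto
      have cont: "continuous_on {T..S} a" "continuous_on {T..S} b" "continuous_on {T..S} g"
        using sub
        by (auto intro!: DERIV_continuous_on[OF has_field_derivative_subset[OF der(1)]]
            DERIV_continuous_on[OF has_field_derivative_subset[OF der(2)]]
            DERIV_continuous_on[OF has_field_derivative_subset[OF der(3)]])
      have full: "at t within {0..} = at t" if "T < t" for t
        using that \<open>0 \<le> T\<close> by (intro at_within_interior) auto
      have rat: "0 \<le> a t \<and> 0 \<le> g t \<and> a t * g t = (b t)\<^sup>2 \<and> a t \<le> - e * b t"
        if "t \<in> \<rat>" "T < t" "t < S" for t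
        using elim(1) \<xi> that unfolding a_def b_def g_def by auto
      note nonneg = nonneg_from_rationals[OF \<open>T < S\<close>]
      have 1: "0 \<le> a t" if "t \<in> {T..S}" for t
        by (rule nonneg[OF cont(1) _ that]) (use rat in auto)
      have 2: "0 \<le> g t" if "t \<in> {T..S}" for t
        by (rule nonneg[OF cont(3) _ that]) (use rat in auto)
      have "0 \<le> a t * g t - (b t)\<^sup>2" if "t \<in> {T..S}" for t
        by (rule nonneg[OF _ _ that]) (use rat cont in \<open>auto intro!: continuous_intros\<close>)
      moreover have "0 \<le> (b t)\<^sup>2 - a t * g t" if "t \<in> {T..S}" for t
        by (rule nonneg[OF _ _ that]) (use rat cont in \<open>auto intro!: continuous_intros\<close>)
      ultimately have 3: "a t * g t = (b t)\<^sup>2" if "t \<in> {T..S}" for t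
        using that by (meson antisym diff_ge_0_iff_ge)
      have "0 \<le> - e * b t - a t" if "t \<in> {T..S}" for t
        by (rule nonneg[OF _ _ that]) (use rat cont in \<open>auto intro!: continuous_intros\<close>)
      then have 4: "a t \<le> - e * b t" if "t \<in> {T..S}" for t
        using that by force
      have 5: "0 \<le> P t" if "t \<in> {T..S}" for t
        unfolding P_def using that \<open>0 \<le> T\<close> by (intro lagrangian_P_nonneg[OF L]) auto
      have 6: "0 \<le> V t \<and> V t \<le> C" if t: "t \<in> {T..S}" for t
      proof -
        have "m \<le> \<phi> (z t \<xi>)" "\<phi> (z t \<xi>) \<le> s"
          using above_m near[OF t, of \<xi>] \<xi> cuspon_profile_le_crest[OF c] by auto
        then have "\<bar>U t \<xi>\<bar> \<le> \<bar>\<bar>m\<bar> + \<bar>s\<bar> + \<bar>\<kappa>\<bar>\<bar>"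
          using Uz[of t \<xi>] t \<open>0 \<le> T\<close> by auto
        then show ?thesis
          unfolding V_def C_def abs_le_square_iff by simp
      qed
      have 7: "0 < g T"
        using elim(1) \<xi> unfolding g_def by blast
      have db: "(b has_real_derivative 1/2 * g t + (V t - P t) * a t) (at t)"
        and dg: "(g has_real_derivative 2 * (V t - P t) * b t) (at t)" if "T < t" for t
        using der(2,3)[of t] full[OF that] that \<open>0 \<le> T\<close> by simp_all
      show False
        by (rule reciprocal_slope_contradiction[OF \<open>0 < e\<close> \<open>C * e\<^sup>2 \<le> 1/4\<close> \<open>4 * e < S - T\<close>
              cont(2,3) db dg 1 2 3 4 5 6 7])
    qed
  qed
  then have "AE \<xi> in lborel. \<xi> \<notin> {\<xi>\<^sub>0<..<q}" by simp
  then have "{\<xi>\<^sub>0<..<q} \<in> null_sets lborel"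
    by (subst (asm) AE_iff_null_sets[symmetric]) auto
  then show False
    using \<open>\<xi>\<^sub>0 < q\<close> by (auto simp: null_sets_def)
qed

theorem mainTheorem3:
  fixes m s M \<kappa> :: real
    and \<phi> :: "real \<Rightarrow> real"
    and u \<zeta> U h \<zeta>\<xi> U\<xi> :: "real \<Rightarrow> real \<Rightarrow> real"
  assumes "m < s" and "s < M"
    and "\<kappa> = 1/2 * (s - 2 * m - M)"
    and "cuspon_profile m s M \<phi>"
    and "u = cuspon_wave \<phi> s \<kappa>"
    and "conservative_solution (m + \<kappa>) u \<zeta> U h \<zeta>\<xi> U\<xi>"
  shows "(\<forall>T \<xi>. T \<ge> 0 \<longrightarrow> characteristic \<zeta> T \<xi> = (s + \<kappa>) * T \<longrightarrow>
            (\<forall>t>T. characteristic \<zeta> t \<xi> < (s + \<kappa>) * t))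
       \<and> \<not> (\<exists>\<xi>. \<forall>t\<ge>0. characteristic \<zeta> t \<xi> = (s + \<kappa>) * t)"
proof -
  have sol: "lagrangian_solution (m + \<kappa>) \<zeta> U h \<zeta>\<xi> U\<xi>"
    using assms(6) unfolding conservative_solution_def by auto
  have wave: "\<phi> (characteristic \<zeta> t \<xi> - (s + \<kappa>) * t) + \<kappa> = U t \<xi>" if "0 \<le> t" for t \<xi>
    using assms(5,6) that unfolding conservative_solution_def cuspon_wave_def by auto
  have leaves: "characteristic \<zeta> t \<xi> < (s + \<kappa>) * t"
    if "0 \<le> T" "characteristic \<zeta> T \<xi> = (s + \<kappa>) * T" "T < t" for T t \<xi>
    using characteristic_leaves_cusp[OF assms(1,2,4) sol wave that] by simp
  moreover have False if "\<forall>t\<ge>0. characteristic \<zeta> t \<xi> = (s + \<kappa>) * t" for \<xi>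
    using leaves[of 0 \<xi> 1] that by force
  ultimately show ?thesis by blast
qed

end
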